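(* Let $\mu$ be a positive integer and let $G$ and $H$ be $\mu$-simultaneous edge colorable graphs. Then the Cartesian product $G\square H$ is $\mu$-simultaneous edge colorable, and $\chi'_{\mu\text{-}SE}(G\square H)\le\chi'_{\mu\text{-}SE}(G)+\chi'_{\mu\text{-}SE}(H)$.
   Context: All graphs are finite and simple; $[l]=\{1,\ldots,l\}$. A $\mu$-simultaneous edge coloring of a graph $G$ is a $\mu$-tuple $(c_1,\ldots,c_\mu)$ of proper edge colorings $c_i:E(G)\to[l]$ (with a common color set $[l]$) such that (1) for every vertex $v$, the set $\{c_i(e): e \text{ incident to } v\}$ is the same for all $i$, and (2) $c_i(e)\neq c_j(e)$ for every edge $e$ and all $i\neq j$. $G$ is $\mu$-simultaneous edge colorable if such a coloring exists for some $l$, and $\chi'_{\mu\text{-}SE}(G)$ is the minimum such $l$. The Cartesian product $G\square H$ has vertex set $V(G)\times V(H)$, with $(u,v)$ adjacent to $(u',v')$ iff either $u=u'$ and $vv'\in E(H)$, or $uu'\in E(G)$ and $v=v'$. *)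

theory Defs
  imports "Graph_Theory.Pair_Digraph"
begin

text \<open>
  Finite simple graphs are the instances of the locale \<^locale>\<open>pair_graph\<close>, in which an
  undirected edge is represented by its two opposite arcs. Colorings have to live on undirected
  edges, so both arcs are identified with the two-element set of end points.
\<close>

definition uedges :: "'a pair_pre_digraph \<Rightarrow> 'a set set" where
  "uedges G = {{u, v} | u v. (u, v) \<in> parcs G}"

definition incident_edges :: "'a pair_pre_digraph \<Rightarrow> 'a \<Rightarrow> 'a set set" where
  "incident_edges G v = {e \<in> uedges G. v \<in> e}"

definition proper_edge_coloring :: "'a pair_pre_digraph \<Rightarrow> nat \<Rightarrow> ('a set \<Rightarrow> nat) \<Rightarrow> bool" where
  "proper_edge_coloring G l c \<longleftrightarrow>
     (\<forall>e \<in> uedges G. c e \<in> {1..l}) \<and>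
     (\<forall>e \<in> uedges G. \<forall>f \<in> uedges G. e \<noteq> f \<and> e \<inter> f \<noteq> {} \<longrightarrow> c e \<noteq> c f)"

text \<open>
  A \<open>\<mu>\<close>-tuple of colorings is a family \<open>c\<close>, of which only the members \<open>c 1, \<dots>, c \<mu>\<close> and
  only their values on edges matter.
\<close>

definition simultaneous_edge_coloring ::
    "nat \<Rightarrow> 'a pair_pre_digraph \<Rightarrow> nat \<Rightarrow> (nat \<Rightarrow> 'a set \<Rightarrow> nat) \<Rightarrow> bool" where
  "simultaneous_edge_coloring \<mu> G l c \<longleftrightarrow>
     (\<forall>i \<in> {1..\<mu>}. proper_edge_coloring G l (c i)) \<and>
     (\<forall>v \<in> pverts G. \<forall>i \<in> {1..\<mu>}. \<forall>j \<in> {1..\<mu>}.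
        c i ` incident_edges G v = c j ` incident_edges G v) \<and>
     (\<forall>e \<in> uedges G. \<forall>i \<in> {1..\<mu>}. \<forall>j \<in> {1..\<mu>}. i \<noteq> j \<longrightarrow> c i e \<noteq> c j e)"

definition simultaneous_edge_colorable :: "nat \<Rightarrow> 'a pair_pre_digraph \<Rightarrow> bool" where
  "simultaneous_edge_colorable \<mu> G \<longleftrightarrow> (\<exists>l c. simultaneous_edge_coloring \<mu> G l c)"

text \<open>
  Unspecified unless \<open>G\<close> is \<open>\<mu>\<close>-simultaneous edge colorable. The empty color set is allowed,
  so edgeless graphs get the value 0.
\<close>

definition SE_chromatic_index :: "nat \<Rightarrow> 'a pair_pre_digraph \<Rightarrow> nat" where
  "SE_chromatic_index \<mu> G = (LEAST l. \<exists>c. simultaneous_edge_coloring \<mu> G l c)"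

definition cartesian_product ::
    "'a pair_pre_digraph \<Rightarrow> 'b pair_pre_digraph \<Rightarrow> ('a \<times> 'b) pair_pre_digraph"
    (infixr \<open>\<box>\<close> 70) where
  "G \<box> H =
     \<lparr> pverts = pverts G \<times> pverts H,
       parcs = {((u, v), (u', v')) | u v u' v'.
          (u, v) \<in> pverts G \<times> pverts H \<and> (u', v') \<in> pverts G \<times> pverts H \<and>
          (u = u' \<and> (v, v') \<in> parcs H \<or> (u, u') \<in> parcs G \<and> v = v')} \<rparr>"

lemma pair_graph_cartesian_product:
  assumes "pair_graph G" "pair_graph H"
  shows "pair_graph (G \<box> H)"
proof -
  interpret G: pair_graph G by fact
  interpret H: pair_graph H by fact
  have sub: "parcs (G \<box> H) \<subseteq> (pverts G \<times> pverts H) \<times> (pverts G \<times> pverts H)"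
    by (auto simp: cartesian_product_def)
  have fin: "finite (parcs (G \<box> H))"
    by (rule finite_subset[OF sub]) simp
  have sy: "symmetric (with_proj (G \<box> H))"
    by (auto simp: symmetric_def sym_def arcs_ends_conv cartesian_product_def with_proj_def
        dest: G.arcs_symmetric H.arcs_symmetric)
  show ?thesis
    using fin sy
    by unfold_locales
      (auto simp: cartesian_product_def dest: G.pair_no_loops H.pair_no_loops
        G.no_loops' H.no_loops')
qed

end

theory Submission
  imports Defs
begin

text \<open>
  Colour the copies of \<open>G\<close> in \<open>G \<box> H\<close> as in \<open>G\<close>, and the copies of \<open>H\<close> as in \<open>H\<close>, with the
  palette of \<open>H\<close> shifted past that of \<open>G\<close>. The colours seen at \<open>(u, v)\<close> are then those seen at
  \<open>u\<close> together with the shifted ones seen at \<open>v\<close>, so all conditions are inherited from the factors.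
\<close>

text \<open>An edge of the product lies in a copy of \<open>G\<close> iff its second projection is a single vertex.\<close>

definition product_coloring ::
    "nat \<Rightarrow> ('a set \<Rightarrow> nat) \<Rightarrow> ('b set \<Rightarrow> nat) \<Rightarrow> ('a \<times> 'b) set \<Rightarrow> nat" where
  "product_coloring l a b e = (if is_singleton (snd ` e) then a (fst ` e) else l + b (snd ` e))"

text \<open>If \<open>g\<close> were empty, the second projection would be empty rather than a
  singleton, and the other branch would apply.\<close>

lemma product_coloring_left: "g \<noteq> {} \<Longrightarrow> product_coloring l a b (g \<times> {v}) = a g"
  by (simp add: product_coloring_def)

lemma product_coloring_right:
  "\<not> is_singleton h \<Longrightarrow> product_coloring l a b ({u} \<times> h) = l + b h"
  by (simp add: product_coloring_def)

lemma uedges_nonempty: "e \<in> uedges G \<Longrightarrow> e \<noteq> {}"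
  by (auto simp: uedges_def)

text \<open>Absence of loops is what keeps an edge inside a copy of \<open>H\<close> from being
  mistaken for one inside a copy of \<open>G\<close>.\<close>

lemma (in pair_graph) uedges_not_singleton: "e \<in> uedges G \<Longrightarrow> \<not> is_singleton e"
  using no_loops' by (fastforce simp: uedges_def is_singleton_def doubleton_eq_iff)

lemma uedges_cartesian_product:
  assumes "pair_graph G" "pair_graph H"
  shows "uedges (G \<box> H) =
    (\<lambda>(g, v). g \<times> {v}) ` (uedges G \<times> pverts H) \<union> (\<lambda>(u, h). {u} \<times> h) ` (pverts G \<times> uedges H)"
    (is "?L = ?R1 \<union> ?R2")
proof (intro equalityI subsetI)
  fix e assume "e \<in> ?L"
  then obtain u v u' v' where e: "e = {(u, v), (u', v')}"
    and V: "u \<in> pverts G" "v \<in> pverts H"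
    and "u = u' \<and> (v, v') \<in> parcs H \<or> (u, u') \<in> parcs G \<and> v = v'"
    by (auto simp: uedges_def cartesian_product_def)
  then consider "e = {u} \<times> {v, v'}" "{v, v'} \<in> uedges H"
    | "e = {u, u'} \<times> {v}" "{u, u'} \<in> uedges G"
    by (auto simp: uedges_def)
  then show "e \<in> ?R1 \<union> ?R2"
  proof cases
    case 1
    with V have "e \<in> ?R2" by (intro image_eqI[of _ _ "(u, {v, v'})"]) auto
    then show ?thesis ..
  next
    case 2
    with V have "e \<in> ?R1" by (intro image_eqI[of _ _ "({u, u'}, v)"]) auto
    then show ?thesis ..
  qed
next
  interpret G: pair_graph G by fact
  interpret H: pair_graph H by fact
  fix e assume "e \<in> ?R1 \<union> ?R2"
  then consider g v where "e = g \<times> {v}" "g \<in> uedges G" "v \<in> pverts H"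
    | u h where "e = {u} \<times> h" "u \<in> pverts G" "h \<in> uedges H"
    by auto
  then show "e \<in> ?L"
  proof cases
    case 1
    then obtain u u' where "(u, u') \<in> parcs G" "e = {(u, v), (u', v)}"
      by (auto simp: uedges_def)
    \<comment> \<open>The product demands that both end points be vertices; for \<open>u\<close> and
      \<open>u'\<close> this follows from their being ends of an arc of \<open>G\<close>.\<close>
    moreover from this have "((u, v), (u', v)) \<in> parcs (G \<box> H)"
      using 1 G.in_arcsD1 G.in_arcsD2 by (fastforce simp: cartesian_product_def)
    ultimately show ?thesis
      unfolding uedges_def by blast
  next
    case 2
    then obtain v v' where "(v, v') \<in> parcs H" "e = {(u, v), (u, v')}"
      by (auto simp: uedges_def)
    moreover from this have "((u, v), (u, v')) \<in> parcs (G \<box> H)"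
      using 2 H.in_arcsD1 H.in_arcsD2 by (fastforce simp: cartesian_product_def)
    ultimately show ?thesis
      unfolding uedges_def by blast
  qed
qed

lemma incident_edges_cartesian_product:
  assumes "pair_graph G" "pair_graph H" "u \<in> pverts G" "v \<in> pverts H"
  shows "incident_edges (G \<box> H) (u, v) =
    (\<lambda>g. g \<times> {v}) ` incident_edges G u \<union> (\<lambda>h. {u} \<times> h) ` incident_edges H v"
  using assms(3,4) by (auto simp: incident_edges_def uedges_cartesian_product[OF assms(1,2)])

text \<open>This settles condition (1): the right-hand side depends on \<open>a\<close> and
  \<open>b\<close> only through the color sets at \<open>u\<close> and \<open>v\<close>, which are
  the same for all members of a simultaneous coloring.\<close>

lemma image_incident_edges_product_coloring:
  assumes "pair_graph G" "pair_graph H" "u \<in> pverts G" "v \<in> pverts H"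
  shows "product_coloring l a b ` incident_edges (G \<box> H) (u, v) =
    a ` incident_edges G u \<union> (+) l ` b ` incident_edges H v"
proof -
  have "product_coloring l a b (g \<times> {v}) = a g" if "g \<in> incident_edges G u" for g
    using that by (auto simp: incident_edges_def intro: product_coloring_left)
  moreover have "product_coloring l a b ({u} \<times> h) = l + b h" if "h \<in> incident_edges H v" for h
    using that pair_graph.uedges_not_singleton[OF assms(2)]
    by (auto simp: incident_edges_def intro: product_coloring_right)
  ultimately show ?thesis
    unfolding incident_edges_cartesian_product[OF assms] image_Un image_image by simp
qed

text \<open>The color is given for all \<open>l\<close>, \<open>a\<close> and \<open>b\<close> at
  once because the branch taken depends on \<open>e\<close> alone. Hence two product colorings of
  the same edge can be compared within one case.\<close>

lemma uedges_cartesian_product_cases: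
  assumes "pair_graph G" "pair_graph H" "e \<in> uedges (G \<box> H)"
  obtains (left) g v where "e = g \<times> {v}" "g \<in> uedges G" "v \<in> pverts H"
      "\<And>l a b. product_coloring l a b e = a g"
    | (right) u h where "e = {u} \<times> h" "u \<in> pverts G" "h \<in> uedges H"
      "\<And>l a b. product_coloring l a b e = l + b h"
  using assms pair_graph.uedges_not_singleton[OF assms(2)]
  by (auto simp: uedges_cartesian_product product_coloring_left product_coloring_right
      uedges_nonempty)

text \<open>Adjacent edges of the same kind lie in the same copy of a factor, where the factor's
  coloring separates them. Edges of different kinds have colors from disjoint palettes.\<close>

lemma proper_edge_coloring_cartesian_product:
  assumes GH: "pair_graph G" "pair_graph H"
    and a: "proper_edge_coloring G l a" and b: "proper_edge_coloring H m b"
  shows "proper_edge_coloring (G \<box> H) (l + m) (product_coloring l a b)"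
    (is "proper_edge_coloring _ _ ?c")
proof -
  have a_range: "a g \<in> {1..l}" if "g \<in> uedges G" for g
    using a that by (simp add: proper_edge_coloring_def)
  have b_range: "b h \<in> {1..m}" if "h \<in> uedges H" for h
    using b that by (simp add: proper_edge_coloring_def)
  have a_neq: "a g \<noteq> a g'" if "g \<in> uedges G" "g' \<in> uedges G" "g \<noteq> g'" "g \<inter> g' \<noteq> {}" for g g'
    using a that unfolding proper_edge_coloring_def by blast
  have b_neq: "b h \<noteq> b h'" if "h \<in> uedges H" "h' \<in> uedges H" "h \<noteq> h'" "h \<inter> h' \<noteq> {}" for h h'
    using b that unfolding proper_edge_coloring_def by blast
  have "?c e \<in> {1..l + m}" if "e \<in> uedges (G \<box> H)" for e
    using GH that
  proof (cases rule: uedges_cartesian_product_cases)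
    case (left g v)
    then show ?thesis using a_range[of g] by auto
  next
    case (right u h)
    then show ?thesis using b_range[of h] by auto
  qed
  moreover have "?c e \<noteq> ?c f"
    if e: "e \<in> uedges (G \<box> H)" and f: "f \<in> uedges (G \<box> H)" and ef: "e \<noteq> f" "e \<inter> f \<noteq> {}" for e f
    using GH e
  proof (cases rule: uedges_cartesian_product_cases)
    case e: (left g v)
    show ?thesis using GH f
    proof (cases rule: uedges_cartesian_product_cases)
      case f: (left g' v')
      \<comment> \<open>A common vertex forces \<open>v = v'\<close>, so distinct edges must differ
        in their \<open>G\<close>-part.\<close>
      with e ef have "g \<noteq> g'" "g \<inter> g' \<noteq> {}" by auto
      with e f a_neq show ?thesis by simp
    next
      case (right u' h')
      \<comment> \<open>Colors start at 1, so \<open>a g \<le> l < l + b h'\<close>.\<close>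
      with e a_range[of g] b_range[of h'] show ?thesis by auto
    qed
  next
    case e: (right u h)
    show ?thesis using GH f
    proof (cases rule: uedges_cartesian_product_cases)
      case (left g' v')
      with e a_range[of g'] b_range[of h] show ?thesis by auto
    next
      case f: (right u' h')
      with e ef have "h \<noteq> h'" "h \<inter> h' \<noteq> {}" by auto
      with e f b_neq show ?thesis by simp
    qed
  qed
  ultimately show ?thesis
    unfolding proper_edge_coloring_def by blast
qed

text \<open>The i-th colorings of the two factors are combined, with the same shift \<open>l\<close>
  for every i, so each inequality or equality of color sets between indices i and j reduces to the
  factors.\<close>

lemma simultaneous_edge_coloring_cartesian_product:
  assumes GH: "pair_graph G" "pair_graph H"
    and a: "simultaneous_edge_coloring \<mu> G l a" and b: "simultaneous_edge_coloring \<mu> H m b"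
  shows "simultaneous_edge_coloring \<mu> (G \<box> H) (l + m) (\<lambda>i. product_coloring l (a i) (b i))"
  unfolding simultaneous_edge_coloring_def
proof (intro conjI ballI impI)
  fix i assume "i \<in> {1..\<mu>}"
  then show "proper_edge_coloring (G \<box> H) (l + m) (product_coloring l (a i) (b i))"
    using a b by (auto simp: simultaneous_edge_coloring_def
        intro: proper_edge_coloring_cartesian_product[OF GH])
next
  fix w i j assume w: "w \<in> pverts (G \<box> H)" and ij: "i \<in> {1..\<mu>}" "j \<in> {1..\<mu>}"
  obtain u v where uv: "w = (u, v)" "u \<in> pverts G" "v \<in> pverts H"
    using w by (auto simp: cartesian_product_def)
  have "a i ` incident_edges G u = a j ` incident_edges G u"
    using a ij uv unfolding simultaneous_edge_coloring_def by blast
  moreover have "b i ` incident_edges H v = b j ` incident_edges H v"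
    using b ij uv unfolding simultaneous_edge_coloring_def by blast
  ultimately show "product_coloring l (a i) (b i) ` incident_edges (G \<box> H) w =
      product_coloring l (a j) (b j) ` incident_edges (G \<box> H) w"
    using uv by (simp add: image_incident_edges_product_coloring[OF GH])
next
  fix e i j assume e: "e \<in> uedges (G \<box> H)" and ij: "i \<in> {1..\<mu>}" "j \<in> {1..\<mu>}" "i \<noteq> j"
  show "product_coloring l (a i) (b i) e \<noteq> product_coloring l (a j) (b j) e"
    using GH e
  proof (cases rule: uedges_cartesian_product_cases)
    case (left g v)
    then show ?thesis using a ij by (simp add: simultaneous_edge_coloring_def)
  next
    case (right u h)
    then show ?thesis using b ij by (simp add: simultaneous_edge_coloring_def)
  qed
qed

text \<open>Colorability makes the set of admissible palette sizes nonempty, so its least element is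
  attained.\<close>

lemma simultaneous_edge_coloring_SE_chromatic_index:
  assumes "simultaneous_edge_colorable \<mu> G"
  obtains c where "simultaneous_edge_coloring \<mu> G (SE_chromatic_index \<mu> G) c"
  using assms LeastI_ex[of "\<lambda>l. \<exists>c. simultaneous_edge_coloring \<mu> G l c"]
  unfolding simultaneous_edge_colorable_def SE_chromatic_index_def by blast

lemma SE_chromatic_index_le:
  "simultaneous_edge_coloring \<mu> G l c \<Longrightarrow> SE_chromatic_index \<mu> G \<le> l"
  unfolding SE_chromatic_index_def by (blast intro: Least_le)

theorem theorem2p14:
  fixes \<mu> :: nat and G :: "'a pair_pre_digraph" and H :: "'b pair_pre_digraph"
  assumes "\<mu> \<ge> 1"
    and "pair_graph G" and "pair_graph H"
    and "simultaneous_edge_colorable \<mu> G" and "simultaneous_edge_colorable \<mu> H"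
  shows "simultaneous_edge_colorable \<mu> (G \<box> H) \<and>
    SE_chromatic_index \<mu> (G \<box> H) \<le> SE_chromatic_index \<mu> G + SE_chromatic_index \<mu> H"
proof -
  obtain a where "simultaneous_edge_coloring \<mu> G (SE_chromatic_index \<mu> G) a"
    using assms(4) by (rule simultaneous_edge_coloring_SE_chromatic_index)
  moreover obtain b where "simultaneous_edge_coloring \<mu> H (SE_chromatic_index \<mu> H) b"
    using assms(5) by (rule simultaneous_edge_coloring_SE_chromatic_index)
  \<comment> \<open>Combining optimal colorings of the factors gives one coloring that both
    witnesses colorability and bounds the minimum.\<close>
  ultimately obtain c where
    "simultaneous_edge_coloring \<mu> (G \<box> H) (SE_chromatic_index \<mu> G + SE_chromatic_index \<mu> H) c"
    using simultaneous_edge_coloring_cartesian_product[OF assms(2,3)] by blast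
  then show ?thesis
    using SE_chromatic_index_le unfolding simultaneous_edge_colorable_def by blast
qed

end
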